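(* Let $\mathcal{H}$ be a separable Hilbert space and let $V=\{(V_i,\upsilon_i)\}_{i\in I}$ be an approximate alternate dual fusion frame of a fusion frame $W=\{(W_i,\omega_i)\}_{i\in I}$ for $\mathcal{H}$, where $W$ has upper fusion frame bound $B$. Let $\epsilon>0$ and let $\{(U_i,\upsilon_i)\}_{i\in I}$ be an $\epsilon$-perturbation of $V$, where $$\epsilon<\left(\frac{1-\|I_{\mathcal{H}}-\psi_{vw}\|}{\sqrt{B}\,\|S_W^{-1}\|}\right)^2 .$$ Then $\{(U_i,\upsilon_i)\}_{i\in I}$ is also an approximate alternate dual fusion frame of $W$. In particular, if $W$ is a Parseval fusion frame and $V=W$, then the conclusion holds whenever $\epsilon<1$.
   Context: $I$ is a countable index set and $\pi_U$ is the orthogonal projection of $\mathcal{H}$ onto a closed subspace $U$. For closed subspaces $W_i\subseteq\mathcal{H}$ and weights $\omega_i>0$, $\{(W_i,\omega_i)\}_{i\in I}$ is a fusion frame if there are $0<A\le B<\infty$ with $A\|f\|^2\le\sum_{i\in I}\omega_i^2\|\pi_{W_i}f\|^2\le B\|f\|^2$ for all $f\in\mathcal{H}$ ($A$, $B$ are the lower and upper bounds); it is Parseval if one can take $A=B=1$, and a Bessel fusion sequence if only the upper inequality is required. The fusion frame operator $S_Wf=\sum_{i\in I}\omega_i^2\pi_{W_i}f$ of a fusion frame is bounded, positive and invertible. For a fusion frame $W=\{(W_i,\omega_i)\}$ and a Bessel fusion sequence $V=\{(V_i,\upsilon_i)\}$ put $\psi_{vw}f=\sum_{i\in I}\omega_i\upsilon_i\pi_{V_i}S_W^{-1}\pi_{W_i}f$,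 $f\in\mathcal{H}$. $V$ is an approximate alternate dual (fusion frame) of $W$ if it is a Bessel fusion sequence with $\|I_{\mathcal{H}}-\psi_{vw}\|<1$. Given closed subspaces $V_i,U_i$ of $\mathcal{H}$, weights $\upsilon_i>0$ and $\epsilon>0$, $\{(U_i,\upsilon_i)\}_{i\in I}$ is an $\epsilon$-perturbation of $\{(V_i,\upsilon_i)\}_{i\in I}$ if $\sum_{i\in I}\upsilon_i^2\|(\pi_{U_i}-\pi_{V_i})f\|^2<\epsilon\|f\|^2$ for every nonzero $f\in\mathcal{H}$. *)

theory Defs
  imports "HOL-Analysis.Analysis"
begin

section \<open>Hilbert spaces over the real or complex numbers\<close>

text \<open>
  A common treatment of real and complex scalars. By \<open>mult_scnj\<close>, \<open>scnj\<close> is the usual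
  conjugation. (By the Gelfand-Mazur theorem a real normed field is isomorphic to the real or
  to the complex numbers, so the class has no other members.)
\<close>

class hilbert_scalar = real_normed_field +
  fixes scnj :: "'a \<Rightarrow> 'a"
  assumes scnj_add: "scnj (x + y) = scnj x + scnj y"
    and scnj_mult: "scnj (x * y) = scnj x * scnj y"
    and scnj_scnj: "scnj (scnj x) = x"
    and mult_scnj: "x * scnj x = ((norm x)\<^sup>2) *\<^sub>R 1"

instantiation real :: hilbert_scalar
begin
definition scnj_real :: "real \<Rightarrow> real" where "scnj_real x = x"
instance by standard (simp_all add: scnj_real_def power2_eq_square)
end

instantiation complex :: hilbert_scalar
begin
definition scnj_complex :: "complex \<Rightarrow> complex" where "scnj_complex = cnj"
instance by standard (simp_all add: scnj_complex_def complex_norm_square[symmetric] scaleR_conv_of_real)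
end

text \<open>
  Completeness comes from the class \<open>banach\<close>. The form is linear in the first argument; it
  is positive definite because it induces the norm.
\<close>

locale hilbert_space = vector_space scl
  for scl :: "'k::hilbert_scalar \<Rightarrow> 'a::banach \<Rightarrow> 'a" +
  fixes ip :: "'a \<Rightarrow> 'a \<Rightarrow> 'k"
  assumes scale_of_real: "scl (of_real r) x = r *\<^sub>R x"
    and ip_add_left: "ip (x + y) z = ip x z + ip y z"
    and ip_scale_left: "ip (scl c x) y = c * ip x y"
    and ip_commute: "ip y x = scnj (ip x y)"
    and ip_same: "ip x x = of_real ((norm x)\<^sup>2)"

lemma hilbert_space_real:
  "hilbert_space scaleR (inner :: 'a::{real_inner,banach} \<Rightarrow> 'a \<Rightarrow> real)"
  by unfold_locales
    (auto simp: scnj_real_def inner_add_left power2_norm_eq_inner scaleR_add_right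
      scaleR_add_left intro: inner_commute)

lemma hilbert_space_complex: "hilbert_space (*) (\<lambda>x y :: complex. x * cnj y)"
  by unfold_locales
    (simp_all add: scnj_complex_def complex_norm_square[symmetric] scaleR_conv_of_real
      algebra_simps)

definition closed_subspace :: "('k::hilbert_scalar \<Rightarrow> 'a::banach \<Rightarrow> 'a) \<Rightarrow> 'a set \<Rightarrow> bool" where
  "closed_subspace scl U \<longleftrightarrow> module.subspace scl U \<and> closed U"

definition proj :: "('a::banach \<Rightarrow> 'a \<Rightarrow> 'k::hilbert_scalar) \<Rightarrow> 'a set \<Rightarrow> 'a \<Rightarrow> 'a" where
  "proj ip U f = (THE u. u \<in> U \<and> (\<forall>v\<in>U. ip (f - u) v = 0))"


section \<open>Fusion frames\<close>

text \<open>
  A family \<open>{(W i, w i)}\<close> indexed by \<open>I\<close> is given by two functions, of which only the values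
  on \<open>I\<close> matter. As \<open>infsum\<close> is \<open>0\<close> for a divergent series, convergence of the series of
  nonnegative reals is demanded wherever such a sum is bounded from above.
\<close>

definition weighted_subspaces ::
  "('k::hilbert_scalar \<Rightarrow> 'a::banach \<Rightarrow> 'a) \<Rightarrow> 'i set \<Rightarrow> ('i \<Rightarrow> 'a set) \<Rightarrow> ('i \<Rightarrow> real) \<Rightarrow> bool"
where
  "weighted_subspaces scl I W w \<longleftrightarrow> (\<forall>i\<in>I. closed_subspace scl (W i) \<and> w i > 0)"

definition fusion_frame_bounds ::
  "('k::hilbert_scalar \<Rightarrow> 'a::banach \<Rightarrow> 'a) \<Rightarrow> ('a \<Rightarrow> 'a \<Rightarrow> 'k) \<Rightarrow> 'i set \<Rightarrow>
    ('i \<Rightarrow> 'a set) \<Rightarrow> ('i \<Rightarrow> real) \<Rightarrow> real \<Rightarrow> real \<Rightarrow> bool"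
where
  "fusion_frame_bounds scl ip I W w A B \<longleftrightarrow>
    weighted_subspaces scl I W w \<and> 0 < A \<and> A \<le> B \<and>
    (\<forall>f. (\<lambda>i. (w i)\<^sup>2 * (norm (proj ip (W i) f))\<^sup>2) summable_on I \<and>
         A * (norm f)\<^sup>2 \<le> (\<Sum>\<^sub>\<infinity>i\<in>I. (w i)\<^sup>2 * (norm (proj ip (W i) f))\<^sup>2) \<and>
         (\<Sum>\<^sub>\<infinity>i\<in>I. (w i)\<^sup>2 * (norm (proj ip (W i) f))\<^sup>2) \<le> B * (norm f)\<^sup>2)"

definition parseval_fusion_frame ::
  "('k::hilbert_scalar \<Rightarrow> 'a::banach \<Rightarrow> 'a) \<Rightarrow> ('a \<Rightarrow> 'a \<Rightarrow> 'k) \<Rightarrow> 'i set \<Rightarrow>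
    ('i \<Rightarrow> 'a set) \<Rightarrow> ('i \<Rightarrow> real) \<Rightarrow> bool"
where
  "parseval_fusion_frame scl ip I W w \<longleftrightarrow> fusion_frame_bounds scl ip I W w 1 1"

definition bessel_fusion_sequence ::
  "('k::hilbert_scalar \<Rightarrow> 'a::banach \<Rightarrow> 'a) \<Rightarrow> ('a \<Rightarrow> 'a \<Rightarrow> 'k) \<Rightarrow> 'i set \<Rightarrow>
    ('i \<Rightarrow> 'a set) \<Rightarrow> ('i \<Rightarrow> real) \<Rightarrow> bool"
where
  "bessel_fusion_sequence scl ip I V v \<longleftrightarrow>
    weighted_subspaces scl I V v \<and>
    (\<exists>B>0. \<forall>f. (\<lambda>i. (v i)\<^sup>2 * (norm (proj ip (V i) f))\<^sup>2) summable_on I \<and>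
         (\<Sum>\<^sub>\<infinity>i\<in>I. (v i)\<^sup>2 * (norm (proj ip (V i) f))\<^sup>2) \<le> B * (norm f)\<^sup>2)"

definition fusion_frame_operator ::
  "('a::banach \<Rightarrow> 'a \<Rightarrow> 'k::hilbert_scalar) \<Rightarrow> 'i set \<Rightarrow> ('i \<Rightarrow> 'a set) \<Rightarrow> ('i \<Rightarrow> real) \<Rightarrow> 'a \<Rightarrow> 'a"
where
  "fusion_frame_operator ip I W w f = (\<Sum>\<^sub>\<infinity>i\<in>I. (w i)\<^sup>2 *\<^sub>R proj ip (W i) f)"

definition psi ::
  "('a::banach \<Rightarrow> 'a \<Rightarrow> 'k::hilbert_scalar) \<Rightarrow> 'i set \<Rightarrow> ('i \<Rightarrow> 'a set) \<Rightarrow> ('i \<Rightarrow> real) \<Rightarrow>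
    ('i \<Rightarrow> 'a set) \<Rightarrow> ('i \<Rightarrow> real) \<Rightarrow> 'a \<Rightarrow> 'a"
where
  "psi ip I V v W w f =
    (\<Sum>\<^sub>\<infinity>i\<in>I. (w i * v i) *\<^sub>R
      proj ip (V i) (inv (fusion_frame_operator ip I W w) (proj ip (W i) f)))"

definition approximate_alternate_dual ::
  "('k::hilbert_scalar \<Rightarrow> 'a::banach \<Rightarrow> 'a) \<Rightarrow> ('a \<Rightarrow> 'a \<Rightarrow> 'k) \<Rightarrow> 'i set \<Rightarrow>
    ('i \<Rightarrow> 'a set) \<Rightarrow> ('i \<Rightarrow> real) \<Rightarrow> ('i \<Rightarrow> 'a set) \<Rightarrow> ('i \<Rightarrow> real) \<Rightarrow> bool"
where
  "approximate_alternate_dual scl ip I V v W w \<longleftrightarrow>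
    bessel_fusion_sequence scl ip I V v \<and> onorm (\<lambda>f. f - psi ip I V v W w f) < 1"

text \<open>\<open>U\<close> is the perturbed family, \<open>V\<close> the original one; both carry the weights \<open>v\<close>.\<close>

definition perturbation ::
  "('k::hilbert_scalar \<Rightarrow> 'a::banach \<Rightarrow> 'a) \<Rightarrow> ('a \<Rightarrow> 'a \<Rightarrow> 'k) \<Rightarrow> 'i set \<Rightarrow> real \<Rightarrow>
    ('i \<Rightarrow> 'a set) \<Rightarrow> ('i \<Rightarrow> 'a set) \<Rightarrow> ('i \<Rightarrow> real) \<Rightarrow> bool"
where
  "perturbation scl ip I \<epsilon> U V v \<longleftrightarrow>
    \<epsilon> > 0 \<and> weighted_subspaces scl I U v \<and> weighted_subspaces scl I V v \<and>
    (\<forall>f. f \<noteq> 0 \<longrightarrow>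
      (\<lambda>i. (v i)\<^sup>2 * (norm (proj ip (U i) f - proj ip (V i) f))\<^sup>2) summable_on I \<and>
      (\<Sum>\<^sub>\<infinity>i\<in>I. (v i)\<^sup>2 * (norm (proj ip (U i) f - proj ip (V i) f))\<^sup>2) < \<epsilon> * (norm f)\<^sup>2)"

end

theory Submission
  imports Defs
begin

text \<open>
  Replacing \<open>V\<close> by \<open>U\<close> changes \<open>\<psi>\<close> by the error operator
  \<open>E f = (\<Sum>i. w\<^sub>i v\<^sub>i (\<pi>\<^bsub>U\<^esub> - \<pi>\<^bsub>V\<^esub>) S\<^sup>-\<^sup>1 \<pi>\<^bsub>W\<^esub> f)\<close>, with the index of the subspaces left out.
  Each difference \<open>\<pi>\<^bsub>U\<^esub> - \<pi>\<^bsub>V\<^esub>\<close> is self-adjoint, so pairing a partial sum of \<open>E f\<close> with a vector \<open>g\<close>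
  moves it onto \<open>g\<close>, where the perturbation hypothesis bounds the square sum by
  \<open>\<epsilon> \<parallel>g\<parallel>\<^sup>2\<close>; the other square sum in Cauchy-Schwarz is at most
  \<open>B \<parallel>S\<^sup>-\<^sup>1\<parallel>\<^sup>2 \<parallel>f\<parallel>\<^sup>2\<close>. Hence \<open>\<parallel>E\<parallel> \<le> \<surd>\<epsilon> \<surd>B \<parallel>S\<^sup>-\<^sup>1\<parallel>\<close>, and the triangle inequality gives
  \<open>\<parallel>I - \<psi>\<^bsub>u\<^esub>\<parallel> \<le> \<parallel>I - \<psi>\<^bsub>v\<^esub>\<parallel> + \<surd>\<epsilon> \<surd>B \<parallel>S\<^sup>-\<^sup>1\<parallel>\<close>, which the hypothesis on \<open>\<epsilon>\<close> keeps below \<open>1\<close>. This is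
  \<open>approximate_alternate_dual_perturbation\<close>. For a Parseval frame \<open>S = I\<close>, so \<open>\<psi> = I\<close> for
  \<open>V = W\<close>, and the estimate is \<open>\<surd>\<epsilon> < 1\<close>.

  The duality estimate is \<open>norm_synthesis_le\<close>, stated for families of self-adjoint operators
  rather than projections so that \<open>mixed_operator_bounds\<close> serves the frame operator, \<open>\<psi>\<close> and
  \<open>E\<close> alike. It rests on the existence of orthogonal projections (\<open>ex1_proj\<close>) and, for
  \<open>S\<^sup>-\<^sup>1\<close>, on the invertibility of coercive operators (\<open>bij_if_coercive\<close>). All estimates
  use only the real part of the inner product, which treats both scalar fields at once.
\<close>

section \<open>Unconditional convergence under a square-summable bound\<close>

text \<open>
  The partial sums are Cauchy because the tails of \<open>h\<close> are small; the series of the norms of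
  \<open>f\<close> may well diverge, so comparison with an absolutely convergent series does not suffice.
\<close>

lemma summable_on_if_dominated:
  fixes f :: "'i \<Rightarrow> 'a::banach" and h :: "'i \<Rightarrow> real"
  assumes h: "h summable_on A" "\<And>i. i \<in> A \<Longrightarrow> 0 \<le> h i" and C: "0 \<le> C"
    and bound: "\<And>F. finite F \<Longrightarrow> F \<subseteq> A \<Longrightarrow> norm (sum f F) \<le> C * sqrt (sum h F)"
  shows "f summable_on A" and "norm (infsum f A) \<le> C * sqrt (infsum h A)"
proof -
  have lim: "(sum h \<longlongrightarrow> infsum h A) (finite_subsets_at_top A)"
    using h(1) by (rule infsum_tendsto)
  have "\<exists>P. eventually P (finite_subsets_at_top A) \<and>
      (\<forall>F F'. P F \<and> P F' \<longrightarrow> dist (sum f F) (sum f F') < e)" if "e > 0" for e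
  proof -
    define d where "d = e / (2 * (C + 1))"
    have d: "d > 0" "C * d < e / 2"
      using that C by (auto simp: d_def field_simps)
    have "\<forall>\<^sub>F F in finite_subsets_at_top A. infsum h A - d\<^sup>2 < sum h F"
      using lim d(1) by (intro order_tendstoD(1)) auto
    then obtain F0 where F0: "finite F0" "F0 \<subseteq> A" "infsum h A - d\<^sup>2 < sum h F0"
      unfolding eventually_finite_subsets_at_top by blast
    have near: "dist (sum f F) (sum f F0) < e / 2" if F: "finite F" "F0 \<subseteq> F" "F \<subseteq> A" for F
    proof -
      have "sum h (F - F0) + sum h F0 = sum h F"
        using F by (simp add: sum.subset_diff[of F0 F])
      also have "\<dots> \<le> infsum h A"
        using h F by (intro finite_sum_le_infsum) auto
      finally have tail: "sum h (F - F0) \<le> d\<^sup>2"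
        using F0 by linarith
      have "dist (sum f F) (sum f F0) = norm (sum f (F - F0))"
        using F by (simp add: dist_norm sum_diff F0(1))
      also have "\<dots> \<le> C * sqrt (sum h (F - F0))"
        using F by (intro bound) auto
      also have "\<dots> \<le> C * d"
        using real_sqrt_le_mono[OF tail] d(1) C by (intro mult_left_mono) auto
      finally show ?thesis
        using d(2) by linarith
    qed
    show ?thesis
    proof (intro exI conjI allI impI)
      show "\<forall>\<^sub>F F in finite_subsets_at_top A. finite F \<and> F0 \<subseteq> F \<and> F \<subseteq> A"
        unfolding eventually_finite_subsets_at_top using F0 by blast
      show "dist (sum f F) (sum f F') < e"
        if "(finite F \<and> F0 \<subseteq> F \<and> F \<subseteq> A) \<and> finite F' \<and> F0 \<subseteq> F' \<and> F' \<subseteq> A" for F F'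
        using near[of F] near[of F'] that dist_triangle_half_l by blast
    qed
  qed
  then have "cauchy_filter (filtermap (sum f) (finite_subsets_at_top A))"
    by (simp add: cauchy_filter_metric_filtermap)
  moreover have "complete (UNIV :: 'a set)"
    by (meson Cauchy_convergent UNIV_I complete_def convergent_def)
  ultimately obtain L where "(sum f \<longlongrightarrow> L) (finite_subsets_at_top A)"
    using complete_uniform[where S = UNIV] by (force simp add: filterlim_def)
  then show summable: "f summable_on A"
    using summable_on_def has_sum_def by blast
  show "norm (infsum f A) \<le> C * sqrt (infsum h A)"
  proof (rule tendsto_le)
    show "((\<lambda>F. norm (sum f F)) \<longlongrightarrow> norm (infsum f A)) (finite_subsets_at_top A)"
      by (intro tendsto_norm infsum_tendsto summable)
    show "((\<lambda>F. C * sqrt (sum h F)) \<longlongrightarrow> C * sqrt (infsum h A)) (finite_subsets_at_top A)"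
      by (intro tendsto_intros lim)
    show "\<forall>\<^sub>F F in finite_subsets_at_top A. norm (sum f F) \<le> C * sqrt (sum h F)"
      by (rule eventually_finite_subsets_at_top_weakI) (use bound in auto)
  qed simp
qed


section \<open>The real inner product of a Hilbert space\<close>

text \<open>
  Polarisation recovers the real part of the inner product from the norm. As an inner product
  over the reals it induces the same norm, and orthogonality to a subspace can be tested with it
  (see \<open>ip_zero_if_real_ip_zero\<close>).
\<close>

definition real_ip :: "'a::real_normed_vector \<Rightarrow> 'a \<Rightarrow> real" where
  "real_ip x y = ((norm (x + y))\<^sup>2 - (norm x)\<^sup>2 - (norm y)\<^sup>2) / 2"

lemma real_ip_same: "real_ip x x = (norm x)\<^sup>2"
  by (simp add: real_ip_def scaleR_2[symmetric] power_mult_distrib)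

lemma real_ip_commute: "real_ip x y = real_ip y x"
  by (simp add: real_ip_def add.commute)

text \<open>
  As the form is defined by the norm, Cauchy-Schwarz is the square of the triangle inequality.
\<close>

lemma real_ip_le: "real_ip x y \<le> norm x * norm y"
proof -
  have "(norm (x + y))\<^sup>2 \<le> (norm x + norm y)\<^sup>2"
    by (simp add: norm_triangle_ineq power_mono)
  then show ?thesis
    by (simp add: real_ip_def power2_sum)
qed

text \<open>A nonnegative real is \<open>x * scnj x\<close> for its square root \<open>x\<close>, hence fixed by \<open>scnj\<close>.\<close>

lemma scnj_of_real: "scnj (of_real r :: 'k::hilbert_scalar) = of_real r"
proof -
  have nonneg: "scnj (of_real s :: 'k) = of_real s" if "0 \<le> s" for s
  proof -
    let ?x = "of_real (sqrt s) :: 'k"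
    have "of_real s = ?x * scnj ?x"
      using that by (simp add: mult_scnj scaleR_conv_of_real)
    then show ?thesis
      by (metis mult.commute scnj_mult scnj_scnj)
  qed
  have "scnj (0 :: 'k) = 0"
    using nonneg[of 0] by simp
  then have "scnj (- x) = - scnj x" for x :: 'k
    by (metis add.right_inverse add_eq_0_iff scnj_add)
  then show ?thesis
    using nonneg[of r] nonneg[of "- r"] by (cases "0 \<le> r") (auto simp: minus_equation_iff)
qed

context hilbert_space
begin

lemma ip_add_right: "ip x (y + z) = ip x y + ip x z"
  by (metis ip_add_left ip_commute scnj_add)

lemma of_real_real_ip: "of_real (2 * real_ip x y) = ip x y + ip y x"
proof -
  have "of_real ((norm (x + y))\<^sup>2) = of_real ((norm x)\<^sup>2) + ip x y + ip y x + of_real ((norm y)\<^sup>2)"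
    by (simp only: ip_same[symmetric] ip_add_left ip_add_right add_ac)
  then have "of_real ((norm (x + y))\<^sup>2 - (norm x)\<^sup>2 - (norm y)\<^sup>2) = ip x y + ip y x"
    by simp
  moreover have "2 * real_ip x y = (norm (x + y))\<^sup>2 - (norm x)\<^sup>2 - (norm y)\<^sup>2"
    by (simp only: real_ip_def) simp
  ultimately show ?thesis
    by (simp only:)
qed

lemma real_ip_add_left: "real_ip (x + y) z = real_ip x z + real_ip y z" for x y z :: 'a
proof -
  have "of_real (2 * real_ip (x + y) z) = (of_real (2 * (real_ip x z + real_ip y z)) :: 'k)"
    unfolding distrib_left of_real_add of_real_real_ip by (simp add: ip_add_left ip_add_right)
  then show ?thesis
    unfolding of_real_eq_iff by simp
qed

lemma real_ip_scaleR_left: "real_ip (r *\<^sub>R x) y = r * real_ip x y" for x y :: 'a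
proof -
  have "ip (r *\<^sub>R x) y = of_real r * ip x y"
    by (metis ip_scale_left scale_of_real)
  moreover from this have "ip y (r *\<^sub>R x) = of_real r * ip y x"
    by (metis ip_commute scnj_mult scnj_of_real)
  ultimately have "of_real (2 * real_ip (r *\<^sub>R x) y) = (of_real (r * (2 * real_ip x y)) :: 'k)"
    unfolding of_real_mult[of r] of_real_real_ip by (simp add: distrib_left)
  then show ?thesis
    unfolding of_real_eq_iff by simp
qed

lemma real_ip_add_right: "real_ip z (x + y) = real_ip z x + real_ip z y" for x y z :: 'a
  using real_ip_add_left by (simp add: real_ip_commute)

lemma real_ip_scaleR_right: "real_ip y (r *\<^sub>R x) = r * real_ip y x" for x y :: 'a
  using real_ip_scaleR_left by (simp add: real_ip_commute)

lemma bounded_linear_real_ip_left: "bounded_linear (\<lambda>x. real_ip x y)" for y :: 'a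
proof (rule bounded_linear_intro)
  show "norm (real_ip x y) \<le> norm x * norm y" for x
  proof -
    have "- real_ip x y = real_ip (- x) y"
      using real_ip_scaleR_left[of "-1" x y] by simp
    then show ?thesis
      using real_ip_le[of x y] real_ip_le[of "- x" y] by (simp add: abs_le_iff)
  qed
qed (simp_all add: real_ip_add_left real_ip_scaleR_left)

lemma real_ip_diff_left: "real_ip (x - y) z = real_ip x z - real_ip y z" for x y z :: 'a
  using bounded_linear_real_ip_left linear_diff bounded_linear.linear by blast

lemma real_ip_diff_right: "real_ip z (x - y) = real_ip z x - real_ip z y" for x y z :: 'a
  using real_ip_diff_left by (simp add: real_ip_commute)

lemma norm_add_square: "(norm (x + y))\<^sup>2 = (norm x)\<^sup>2 + 2 * real_ip x y + (norm y)\<^sup>2"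
  by (simp add: real_ip_def field_simps)

lemma norm_diff_square: "(norm (x - y))\<^sup>2 = (norm x)\<^sup>2 - 2 * real_ip x y + (norm y)\<^sup>2" for x y :: 'a
  by (simp add: real_ip_same[symmetric] real_ip_diff_left real_ip_diff_right real_ip_commute)


section \<open>Orthogonal projections\<close>

lemma closed_subspace_facts:
  assumes "closed_subspace scl U"
  shows "closed U" and "0 \<in> U" and "x \<in> U \<Longrightarrow> y \<in> U \<Longrightarrow> x + y \<in> U"
    and "x \<in> U \<Longrightarrow> scl c x \<in> U" and "x \<in> U \<Longrightarrow> r *\<^sub>R x \<in> U"
    and "x \<in> U \<Longrightarrow> y \<in> U \<Longrightarrow> x - y \<in> U"
  using assms subspace_0 subspace_add subspace_scale subspace_diff
  by (auto simp: closed_subspace_def simp flip: scale_of_real)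

text \<open>
  The real form sees the whole scalar \<open>c = ip x v\<close> because \<open>U\<close> is closed under scalars: paired
  with \<open>x\<close>, the vector \<open>scl c v\<close> gives the real number \<open>\<parallel>c\<parallel>\<^sup>2\<close>.
\<close>

lemma ip_zero_if_real_ip_zero:
  assumes U: "closed_subspace scl U" and orth: "\<And>v. v \<in> U \<Longrightarrow> real_ip x v = 0" and v: "v \<in> U"
  shows "ip x v = 0"
proof -
  define c where "c = ip x v"
  have c': "ip v x = scnj c"
    unfolding c_def by (rule ip_commute)
  have 1: "ip (scl c v) x = of_real ((norm c)\<^sup>2)"
    by (simp add: ip_scale_left c' mult_scnj scaleR_conv_of_real)
  then have 2: "ip x (scl c v) = of_real ((norm c)\<^sup>2)"
    by (metis ip_commute scnj_of_real)
  have "real_ip x (scl c v) = 0"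
    by (rule orth) (rule closed_subspace_facts(4)[OF U v])
  then have "of_real (2 * (norm c)\<^sup>2) = (0 :: 'k)"
    using of_real_real_ip[of x "scl c v"] 1 2 by simp
  then show ?thesis
    unfolding of_real_eq_0_iff by (simp add: c_def)
qed

text \<open>
  By the parallelogram law, two points of \<open>U\<close> whose squared distance to \<open>f\<close> exceeds the infimum
  by little are close to each other. The sets of such points are thus nested closed sets of
  shrinking diameter, and completeness provides a common point.
\<close>

lemma ex_nearest_point:
  assumes U: "closed_subspace scl U"
  obtains u where "u \<in> U" and "\<And>v. v \<in> U \<Longrightarrow> norm (f - u) \<le> norm (f - v)"
proof -
  define d where "d = (INF v\<in>U. (norm (f - v))\<^sup>2)"
  have ne: "U \<noteq> {}" and bdd: "bdd_below ((\<lambda>v. (norm (f - v))\<^sup>2) ` U)"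
    using closed_subspace_facts(2)[OF U] by (auto intro: bdd_belowI2[of _ 0])
  have lower: "d \<le> (norm (f - v))\<^sup>2" if "v \<in> U" for v
    unfolding d_def using bdd that by (rule cINF_lower)
  define S where "S n = U \<inter> {v. (norm (f - v))\<^sup>2 \<le> d + 1 / Suc n}" for n
  have "\<exists>u. \<forall>n. u \<in> S n"
  proof (rule decreasing_closed_nest[of S])
    show "closed (S n)" for n
      unfolding S_def
      by (intro closed_Int closed_Collect_le continuous_intros closed_subspace_facts(1)[OF U])
    show "S n \<noteq> {}" for n
    proof -
      have "(INF v\<in>U. (norm (f - v))\<^sup>2) < d + 1 / Suc n"
        by (simp add: d_def)
      then show ?thesis
        using cINF_less_iff[OF ne bdd] by (force simp: S_def)
    qed
    show "S n \<subseteq> S m" if "m \<le> n" for m n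
    proof -
      have "1 / real (Suc n) \<le> 1 / real (Suc m)"
        using that by (simp add: frac_le)
      then show ?thesis
        by (auto simp: S_def)
    qed
    show "\<exists>n. \<forall>x\<in>S n. \<forall>y\<in>S n. dist x y < e" if e: "e > 0" for e
    proof -
      obtain n where n: "1 / real (Suc n) < e\<^sup>2 / 4"
        using nat_approx_posE[of "e\<^sup>2 / 4"] e by (metis zero_less_divide_iff zero_less_numeral zero_less_power)
      have "dist x y < e" if xy: "x \<in> S n" "y \<in> S n" for x y
      proof -
        let ?m = "(1 / 2) *\<^sub>R (x + y)"
        have "?m \<in> U"
          using xy closed_subspace_facts(3,5)[OF U] by (simp add: S_def)
        then have mid: "d \<le> (norm (f - ?m))\<^sup>2"
          by (rule lower)
        \<comment> \<open>parallelogram law for \<open>f - x\<close> and \<open>f - y\<close>, whose half sum is \<open>f - ?m\<close>\<close>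
        have "(f - x) + (f - y) = 2 *\<^sub>R (f - ?m)"
          by (simp add: scaleR_diff_right scaleR_2)
        then have "(norm ((f - x) + (f - y)))\<^sup>2 = 4 * (norm (f - ?m))\<^sup>2"
          by (simp add: power_mult_distrib)
        moreover have "(norm (x - y))\<^sup>2 = (norm ((f - y) - (f - x)))\<^sup>2"
          by (simp add: algebra_simps)
        ultimately have "(norm (x - y))\<^sup>2
            = 2 * (norm (f - x))\<^sup>2 + 2 * (norm (f - y))\<^sup>2 - 4 * (norm (f - ?m))\<^sup>2"
          using norm_add_square[of "f - x" "f - y"] norm_diff_square[of "f - y" "f - x"]
          by (simp add: real_ip_commute)
        also have "\<dots> \<le> 4 * (1 / real (Suc n))"
          using xy mid by (auto simp: S_def)
        also have "\<dots> < e\<^sup>2"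
          using n by simp
        finally show ?thesis
          using e by (simp add: dist_norm power_less_imp_less_base)
      qed
      then show ?thesis
        by blast
    qed
  qed blast
  then obtain u where u: "\<And>n. u \<in> S n"
    by blast
  have "(norm (f - u))\<^sup>2 \<le> d"
  proof (rule field_le_epsilon)
    fix e :: real assume "e > 0"
    then obtain n where "1 / real (Suc n) < e"
      by (rule nat_approx_posE)
    then show "(norm (f - u))\<^sup>2 \<le> d + e"
      using u[of n] by (simp add: S_def)
  qed
  then have "norm (f - u) \<le> norm (f - v)" if "v \<in> U" for v
    using lower[OF that] by (meson norm_ge_zero order_trans power2_le_imp_le)
  then show ?thesis
    using that u by (auto simp: S_def)
qed

text \<open>This makes the definite description in \<open>proj\<close> meaningful.\<close>

lemma ex1_proj:
  assumes U: "closed_subspace scl U"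
  shows "\<exists>!u. u \<in> U \<and> (\<forall>v\<in>U. ip (f - u) v = 0)"
proof (rule ex_ex1I)
  obtain u where u: "u \<in> U" "\<And>v. v \<in> U \<Longrightarrow> norm (f - u) \<le> norm (f - v)"
    using ex_nearest_point[OF U, of f] by blast
  have "real_ip (f - u) v = 0" if v: "v \<in> U" for v
  proof -
    let ?r = "real_ip (f - u) v"
    \<comment> \<open>the step along \<open>v\<close> is short enough for its linear gain to beat its quadratic cost\<close>
    define t where "t = ?r / (1 + (norm v)\<^sup>2)"
    have pos: "1 + (norm v)\<^sup>2 > 0"
      by (simp add: add_pos_nonneg)
    have "norm (f - u) \<le> norm (f - (u + t *\<^sub>R v))"
      using u(1) v closed_subspace_facts(3,5)[OF U] by (intro u(2)) simp
    also have "f - (u + t *\<^sub>R v) = (f - u) - t *\<^sub>R v"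
      by simp
    finally have "(norm (f - u))\<^sup>2 \<le> (norm ((f - u) - t *\<^sub>R v))\<^sup>2"
      by (simp add: power_mono)
    also have "\<dots> = (norm (f - u))\<^sup>2 - 2 * (t * ?r) + t\<^sup>2 * (norm v)\<^sup>2"
      by (simp add: norm_diff_square real_ip_scaleR_right power_mult_distrib)
    finally have "2 * (t * ?r) \<le> t\<^sup>2 * (norm v)\<^sup>2"
      by simp
    moreover have "?r = t * (1 + (norm v)\<^sup>2)"
      using pos by (simp add: t_def)
    ultimately have "t\<^sup>2 * (2 + (norm v)\<^sup>2) \<le> 0"
      by (simp add: algebra_simps power2_eq_square)
    moreover have "0 < 2 + (norm v)\<^sup>2"
      by (simp add: add_pos_nonneg)
    ultimately have "t = 0"
      by (simp add: mult_le_0_iff)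
    then show ?thesis
      using pos by (simp add: t_def)
  qed
  then have "\<forall>v\<in>U. ip (f - u) v = 0"
    using ip_zero_if_real_ip_zero[OF U] by blast
  then show "\<exists>u. u \<in> U \<and> (\<forall>v\<in>U. ip (f - u) v = 0)"
    using u(1) by blast
next
  fix u u' assume u: "u \<in> U \<and> (\<forall>v\<in>U. ip (f - u) v = 0)"
    and u': "u' \<in> U \<and> (\<forall>v\<in>U. ip (f - u') v = 0)"
  then have "u - u' \<in> U"
    using closed_subspace_facts(6)[OF U] by blast
  moreover have "ip (u - u') v + ip (f - u) v = ip (f - u') v" for v
    unfolding ip_add_left[symmetric] by simp
  ultimately have "ip (u - u') (u - u') = 0"
    using u u' by (metis add.right_neutral)
  then have "of_real ((norm (u - u'))\<^sup>2) = (0 :: 'k)"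
    by (simp only: ip_same)
  then show "u = u'"
    unfolding of_real_eq_0_iff by simp
qed

lemma proj_in:
  assumes "closed_subspace scl U"
  shows "proj ip U f \<in> U"
  unfolding proj_def using theI'[OF ex1_proj[OF assms]] by blast

lemma real_ip_proj:
  assumes U: "closed_subspace scl U" and v: "v \<in> U"
  shows "real_ip (proj ip U f) v = real_ip f v"
proof -
  have 1: "ip (f - proj ip U f) v = 0"
    unfolding proj_def using theI'[OF ex1_proj[OF U]] v by blast
  then have "ip v (f - proj ip U f) = 0"
    using scnj_of_real[of 0] by (metis ip_commute of_real_0)
  with 1 have "of_real (2 * real_ip (f - proj ip U f) v) = (0 :: 'k)"
    by (simp only: of_real_real_ip) simp
  then show ?thesis
    unfolding of_real_eq_0_iff by (simp add: real_ip_diff_left)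
qed

lemma proj_unique:
  assumes U: "closed_subspace scl U" and u: "u \<in> U"
    and orth: "\<And>v. v \<in> U \<Longrightarrow> real_ip u v = real_ip f v"
  shows "proj ip U f = u"
proof -
  have "ip (f - u) v = 0" if "v \<in> U" for v
    using that orth by (intro ip_zero_if_real_ip_zero[OF U]) (auto simp: real_ip_diff_left)
  then show ?thesis
    unfolding proj_def using ex1_proj[OF U] u by (blast intro: the1_equality)
qed

lemma proj_idem:
  assumes "closed_subspace scl U"
  shows "proj ip U (proj ip U f) = proj ip U f"
  using assms by (intro proj_unique proj_in) auto

lemma linear_proj:
  assumes U: "closed_subspace scl U"
  shows "linear (proj ip U)"
  using closed_subspace_facts[OF U] proj_in[OF U]
  by (intro linearI proj_unique[OF U])
    (auto simp: real_ip_add_left real_ip_scaleR_left real_ip_proj[OF U])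

lemma proj_self_adjoint:
  assumes U: "closed_subspace scl U"
  shows "real_ip (proj ip U f) g = real_ip f (proj ip U g)"
  by (metis U proj_in real_ip_commute real_ip_proj)


section \<open>Bessel families of self-adjoint operators\<close>

text \<open>
  Self-adjointness and the square-sum bound are what orthogonal projections share with their
  differences, which are no projections but make up the error operator.
\<close>

definition bessel_family :: "'i set \<Rightarrow> ('i \<Rightarrow> real) \<Rightarrow> ('i \<Rightarrow> 'a \<Rightarrow> 'a) \<Rightarrow> real \<Rightarrow> bool" where
  "bessel_family I w P D \<longleftrightarrow>
    (\<forall>i\<in>I. linear (P i) \<and> (\<forall>f g. real_ip (P i f) g = real_ip f (P i g))) \<and> 0 \<le> D \<and>
    (\<forall>f. (\<lambda>i. (w i)\<^sup>2 * (norm (P i f))\<^sup>2) summable_on I \<and>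
         (\<Sum>\<^sub>\<infinity>i\<in>I. (w i)\<^sup>2 * (norm (P i f))\<^sup>2) \<le> D * (norm f)\<^sup>2)"

lemma bessel_family_sum_le:
  assumes "bessel_family I w P D" "finite F" "F \<subseteq> I"
  shows "(\<Sum>i\<in>F. (w i)\<^sup>2 * (norm (P i f))\<^sup>2) \<le> D * (norm f)\<^sup>2"
  using assms finite_sum_le_infsum[of "\<lambda>i. (w i)\<^sup>2 * (norm (P i f))\<^sup>2" I F]
  unfolding bessel_family_def by (meson order_trans zero_le_mult_iff zero_le_power2)

text \<open>
  The squared norm of the sum \<open>s\<close> is its pairing with itself. Moving each \<open>R i\<close> over to \<open>s\<close>
  leaves a sum of products that Cauchy-Schwarz splits into the square sum of \<open>c\<close> and the one of
  \<open>R i s\<close>; the Bessel bound turns the latter into a multiple of \<open>\<parallel>s\<parallel>\<close>, which cancels.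
\<close>

lemma norm_synthesis_le:
  assumes R: "bessel_family I v R D" and F: "finite F" "F \<subseteq> I"
  shows "norm (\<Sum>i\<in>F. v i *\<^sub>R R i (c i)) \<le> sqrt D * sqrt (\<Sum>i\<in>F. (norm (c i))\<^sup>2)"
proof -
  define s where "s = (\<Sum>i\<in>F. v i *\<^sub>R R i (c i))"
  have adj: "real_ip (R i f) g = real_ip f (R i g)" if "i \<in> F" for i f g
    using R F that unfolding bessel_family_def by blast
  have "(norm s)\<^sup>2 = real_ip (\<Sum>i\<in>F. v i *\<^sub>R R i (c i)) s"
    by (simp add: s_def real_ip_same)
  also have "\<dots> = (\<Sum>i\<in>F. real_ip (v i *\<^sub>R R i (c i)) s)"
    by (rule linear_sum[OF bounded_linear.linear[OF bounded_linear_real_ip_left]])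
  also have "\<dots> = (\<Sum>i\<in>F. real_ip (c i) (v i *\<^sub>R R i s))"
    by (intro sum.cong refl) (simp add: real_ip_scaleR_left real_ip_scaleR_right adj)
  also have "\<dots> \<le> (\<Sum>i\<in>F. \<bar>norm (c i)\<bar> * \<bar>norm (v i *\<^sub>R R i s)\<bar>)"
    by (intro sum_mono) (simp add: real_ip_le del: norm_scaleR)
  also have "\<dots> \<le> L2_set (\<lambda>i. norm (c i)) F * L2_set (\<lambda>i. norm (v i *\<^sub>R R i s)) F"
    by (rule L2_set_mult_ineq)
  also have "\<dots> \<le> L2_set (\<lambda>i. norm (c i)) F * (sqrt D * norm s)"
  proof (rule mult_left_mono)
    have "L2_set (\<lambda>i. norm (v i *\<^sub>R R i s)) F \<le> sqrt (D * (norm s)\<^sup>2)"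
      using bessel_family_sum_le[OF R F, of s] by (simp add: L2_set_def power_mult_distrib)
    then show "L2_set (\<lambda>i. norm (v i *\<^sub>R R i s)) F \<le> sqrt D * norm s"
      by (simp add: real_sqrt_mult)
  qed (rule L2_set_nonneg)
  finally have "norm s * norm s \<le> (sqrt D * L2_set (\<lambda>i. norm (c i)) F) * norm s"
    by (simp add: power2_eq_square mult_ac)
  moreover have "0 \<le> sqrt D * L2_set (\<lambda>i. norm (c i)) F"
    using R by (simp add: bessel_family_def L2_set_nonneg)
  ultimately have "norm s \<le> sqrt D * L2_set (\<lambda>i. norm (c i)) F"
    by (cases "norm s = 0") (auto simp: mult_le_cancel_right)
  then show ?thesis
    by (simp add: s_def L2_set_def)
qed

text \<open>
  The common shape of the fusion frame operator (\<open>R = P\<close>, \<open>T\<close> the identity), of \<open>\<psi>\<close> and of its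
  change under a perturbation (\<open>T\<close> the inverse of the frame operator).
\<close>

definition mixed_operator ::
  "'i set \<Rightarrow> ('i \<Rightarrow> real) \<Rightarrow> ('i \<Rightarrow> 'a \<Rightarrow> 'a) \<Rightarrow> ('a \<Rightarrow> 'a) \<Rightarrow> ('i \<Rightarrow> real) \<Rightarrow> ('i \<Rightarrow> 'a \<Rightarrow> 'a) \<Rightarrow> 'a \<Rightarrow> 'a"
where
  "mixed_operator I v R T w P f = (\<Sum>\<^sub>\<infinity>i\<in>I. (w i * v i) *\<^sub>R R i (T (P i f)))"

text \<open>
  Apply the synthesis estimate to \<open>c i = w i *\<^sub>R T (P i f)\<close>, whose square sum is at most
  \<open>(onorm T)\<^sup>2 * B * (norm f)\<^sup>2\<close>.
\<close>

lemma mixed_operator_bounds: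
  assumes R: "bessel_family I v R D" and P: "bessel_family I w P B" and T: "bounded_linear T"
  shows "(\<lambda>i. (w i * v i) *\<^sub>R R i (T (P i f))) summable_on I" (is ?sum)
    and "norm (mixed_operator I v R T w P f) \<le> sqrt D * sqrt B * onorm T * norm f" (is ?norm)
    and "bounded_linear (mixed_operator I v R T w P)"
proof -
  have linR: "linear (R i)" and linP: "linear (P i)" if "i \<in> I" for i
    using R P that by (auto simp: bessel_family_def)
  have D: "0 \<le> D"
    using R by (simp add: bessel_family_def)
  have both: "(\<lambda>i. (w i * v i) *\<^sub>R R i (T (P i f))) summable_on I \<and>
      norm (mixed_operator I v R T w P f) \<le> sqrt D * sqrt B * onorm T * norm f" for f
  proof -
    define h where "h i = (onorm T)\<^sup>2 * ((w i)\<^sup>2 * (norm (P i f))\<^sup>2)" for i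
    have h: "h summable_on I" "infsum h I \<le> (onorm T)\<^sup>2 * (B * (norm f)\<^sup>2)"
      using P unfolding bessel_family_def h_def
      by (auto simp: infsum_cmult_right' intro!: summable_on_cmult_right mult_left_mono)
    have nonneg: "0 \<le> h i" for i
      by (simp add: h_def)
    have bound: "norm (\<Sum>i\<in>F. (w i * v i) *\<^sub>R R i (T (P i f))) \<le> sqrt D * sqrt (sum h F)"
      if F: "finite F" "F \<subseteq> I" for F
    proof -
      have "(\<Sum>i\<in>F. (w i * v i) *\<^sub>R R i (T (P i f))) = (\<Sum>i\<in>F. v i *\<^sub>R R i (w i *\<^sub>R T (P i f)))"
        using F by (intro sum.cong refl) (auto simp: linear_scale[OF linR] subset_iff mult.commute)
      then have "norm (\<Sum>i\<in>F. (w i * v i) *\<^sub>R R i (T (P i f)))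
          \<le> sqrt D * sqrt (\<Sum>i\<in>F. (norm (w i *\<^sub>R T (P i f)))\<^sup>2)"
        by (simp only: norm_synthesis_le[OF R F])
      also have "\<dots> \<le> sqrt D * sqrt (sum h F)"
      proof (intro mult_left_mono real_sqrt_le_mono sum_mono)
        fix i
        have "(norm (T (P i f)))\<^sup>2 \<le> (onorm T * norm (P i f))\<^sup>2"
          by (intro power_mono onorm T) simp
        then have "(w i)\<^sup>2 * (norm (T (P i f)))\<^sup>2 \<le> (w i)\<^sup>2 * (onorm T * norm (P i f))\<^sup>2"
          by (rule mult_left_mono) simp
        then show "(norm (w i *\<^sub>R T (P i f)))\<^sup>2 \<le> h i"
          by (simp add: h_def power_mult_distrib mult_ac)
      qed (simp add: D)
      finally show ?thesis .
    qed
    note dom = summable_on_if_dominated[OF h(1) nonneg _ bound]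
    have "norm (mixed_operator I v R T w P f) \<le> sqrt D * sqrt (infsum h I)"
      unfolding mixed_operator_def using dom(2) D by simp
    also have "\<dots> \<le> sqrt D * sqrt ((onorm T)\<^sup>2 * (B * (norm f)\<^sup>2))"
      using h(2) D by (intro mult_left_mono real_sqrt_le_mono) auto
    also have "\<dots> = sqrt D * sqrt B * onorm T * norm f"
      using onorm_pos_le[OF T] by (simp add: real_sqrt_mult)
    finally show ?thesis
      using dom(1) D by simp
  qed
  then show ?sum ?norm
    by auto
  show "bounded_linear (mixed_operator I v R T w P)"
  proof (rule bounded_linear_intro)
    interpret T: bounded_linear T by (rule T)
    fix f g :: 'a and r :: real
    show "mixed_operator I v R T w P (f + g)
        = mixed_operator I v R T w P f + mixed_operator I v R T w P g"
      unfolding mixed_operator_def using both[of f] both[of g]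
      by (subst infsum_add[symmetric])
        (auto intro!: infsum_cong simp: linear_add[OF linR] linear_add[OF linP] T.add algebra_simps)
    show "mixed_operator I v R T w P (r *\<^sub>R f) = r *\<^sub>R mixed_operator I v R T w P f"
      unfolding mixed_operator_def using both[of f]
      by (subst infsum_scaleR_right[symmetric])
        (auto intro!: infsum_cong simp: linear_scale[OF linR] linear_scale[OF linP] T.scaleR algebra_simps)
    show "norm (mixed_operator I v R T w P f) \<le> norm f * (sqrt D * sqrt B * onorm T)"
      using both[of f] by (simp add: mult_ac)
  qed
qed


section \<open>The fusion frame operator\<close>

lemma bessel_family_proj:
  assumes "weighted_subspaces scl I V v" and "0 \<le> D"
    and "\<And>f. (\<lambda>i. (v i)\<^sup>2 * (norm (proj ip (V i) f))\<^sup>2) summable_on I"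
    and "\<And>f. (\<Sum>\<^sub>\<infinity>i\<in>I. (v i)\<^sup>2 * (norm (proj ip (V i) f))\<^sup>2) \<le> D * (norm f)\<^sup>2"
  shows "bessel_family I v (\<lambda>i. proj ip (V i)) D"
  using assms linear_proj proj_self_adjoint
  unfolding bessel_family_def weighted_subspaces_def by blast

lemma bessel_family_if_bessel_fusion_sequence:
  assumes "bessel_fusion_sequence scl ip I V v"
  shows "\<exists>D. bessel_family I v (\<lambda>i. proj ip (V i)) D"
proof -
  obtain D where "D > 0"
    "\<forall>f. (\<lambda>i. (v i)\<^sup>2 * (norm (proj ip (V i) f))\<^sup>2) summable_on I \<and>
      (\<Sum>\<^sub>\<infinity>i\<in>I. (v i)\<^sup>2 * (norm (proj ip (V i) f))\<^sup>2) \<le> D * (norm f)\<^sup>2"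
    using assms unfolding bessel_fusion_sequence_def by blast
  then have "bessel_family I v (\<lambda>i. proj ip (V i)) D"
    using assms by (intro bessel_family_proj) (auto simp: bessel_fusion_sequence_def)
  then show ?thesis
    by blast
qed

lemma fusion_frame_bessel_family:
  assumes "fusion_frame_bounds scl ip I W w A B"
  shows "bessel_family I w (\<lambda>i. proj ip (W i)) B"
  using assms by (intro bessel_family_proj) (auto simp: fusion_frame_bounds_def)

lemma fusion_frame_operator_eq_mixed:
  assumes "weighted_subspaces scl I W w"
  shows "fusion_frame_operator ip I W w
    = mixed_operator I w (\<lambda>i. proj ip (W i)) (\<lambda>x. x) w (\<lambda>i. proj ip (W i))"
  using assms unfolding fusion_frame_operator_def mixed_operator_def weighted_subspaces_def
  by (auto intro!: ext infsum_cong simp: proj_idem power2_eq_square)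

text \<open>
  Coercivity is the lower frame bound, since \<open>real_ip (S f) f\<close> is the square sum
  of the weighted projections of \<open>f\<close> (projections are idempotent and self-adjoint).
\<close>

lemma fusion_frame_operator_facts:
  assumes W: "fusion_frame_bounds scl ip I W w A B"
  defines "S \<equiv> fusion_frame_operator ip I W w"
  shows "bounded_linear S" and "norm (S f) \<le> B * norm f" and "A * (norm f)\<^sup>2 \<le> real_ip (S f) f"
proof -
  let ?P = "\<lambda>i. proj ip (W i)"
  have sub: "weighted_subspaces scl I W w" and B: "0 \<le> B"
    using W by (auto simp: fusion_frame_bounds_def)
  have S: "S = mixed_operator I w ?P (\<lambda>x. x) w ?P"
    unfolding S_def by (rule fusion_frame_operator_eq_mixed[OF sub])
  note P = fusion_frame_bessel_family[OF W]
  note bounds = mixed_operator_bounds[OF P P bounded_linear_ident]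
  show "bounded_linear S"
    unfolding S by (rule bounds)
  have "norm (S f) \<le> sqrt B * sqrt B * onorm (\<lambda>x::'a. x) * norm f"
    unfolding S by (rule bounds)
  also have "\<dots> \<le> B * 1 * norm f"
    using B onorm_id_le by (intro mult_mono mult_nonneg_nonneg) (auto simp: onorm_pos_le)
  finally show "norm (S f) \<le> B * norm f"
    by simp
  have "real_ip (S f) f = (\<Sum>\<^sub>\<infinity>i\<in>I. real_ip ((w i * w i) *\<^sub>R ?P i (?P i f)) f)"
    unfolding S mixed_operator_def
    by (rule infsumI[symmetric])
      (rule has_sum_bounded_linear[OF bounded_linear_real_ip_left has_sum_infsum[OF bounds(1)]])
  also have "\<dots> = (\<Sum>\<^sub>\<infinity>i\<in>I. (w i)\<^sup>2 * (norm (?P i f))\<^sup>2)"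
    using sub by (intro infsum_cong)
      (simp add: weighted_subspaces_def real_ip_scaleR_left proj_self_adjoint[of _ _ f]
        real_ip_same power2_eq_square[of "w _"])
  finally show "A * (norm f)\<^sup>2 \<le> real_ip (S f) f"
    using W by (simp add: fusion_frame_bounds_def)
qed

text \<open>
  Injectivity and the bound on the inverse follow from \<open>A * norm f \<le> norm (S f)\<close>. For
  surjectivity, a solution of \<open>S f = g\<close> is a fixed point of \<open>f \<mapsto> f - t (S f - g)\<close>, and
  coercivity makes this map a contraction for small \<open>t > 0\<close>.
\<close>

lemma bij_if_coercive:
  fixes S :: "'a \<Rightarrow> 'a"
  assumes S: "bounded_linear S" and bound: "\<And>f. norm (S f) \<le> B * norm f"
    and coercive: "\<And>f. A * (norm f)\<^sup>2 \<le> real_ip (S f) f" and AB: "0 < A" "A \<le> B"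
  shows "bij S" and "bounded_linear (inv S)"
proof -
  interpret S: bounded_linear S by (rule S)
  have below: "A * norm f \<le> norm (S f)" for f
  proof -
    have "A * norm f * norm f \<le> norm (S f) * norm f"
      using order_trans[OF coercive real_ip_le, of f] by (simp add: power2_eq_square mult.assoc)
    then show ?thesis
      by (cases "f = 0") (auto simp: mult_le_cancel_right)
  qed
  have "\<exists>f. S f = g" for g
  proof -
    \<comment> \<open>this step length minimises the contraction factor \<open>1 - 2 t A + t\<^sup>2 B\<^sup>2\<close>\<close>
    define t where "t = A / B\<^sup>2"
    define T where "T f = f - t *\<^sub>R (S f - g)" for f
    define c where "c = sqrt (1 - A\<^sup>2 / B\<^sup>2)"
    have t: "0 < t" and c: "0 \<le> c" "c < 1" and c2: "c\<^sup>2 = 1 - A\<^sup>2 / B\<^sup>2"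
      using AB by (auto simp: t_def c_def power_mono)
    have "dist (T x) (T y) \<le> c * dist x y" for x y
    proof -
      let ?d = "x - y"
      have "T x - T y = ?d - t *\<^sub>R S ?d"
        by (simp add: T_def S.diff algebra_simps)
      then have "(norm (T x - T y))\<^sup>2
          = (norm ?d)\<^sup>2 - 2 * t * real_ip (S ?d) ?d + t\<^sup>2 * (norm (S ?d))\<^sup>2"
        using norm_diff_square[of ?d "t *\<^sub>R S ?d"]
        by (simp add: real_ip_scaleR_right power_mult_distrib real_ip_commute[of ?d])
      also have "\<dots> \<le> (norm ?d)\<^sup>2 - 2 * t * (A * (norm ?d)\<^sup>2) + t\<^sup>2 * (B * norm ?d)\<^sup>2"
        using t by (intro add_mono diff_mono mult_left_mono power_mono coercive bound) auto
      also have "\<dots> = (1 - 2 * (t * A) + t\<^sup>2 * B\<^sup>2) * (norm ?d)\<^sup>2"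
        by (simp add: algebra_simps)
      also have "1 - 2 * (t * A) + t\<^sup>2 * B\<^sup>2 = c\<^sup>2"
        unfolding c2 t_def using AB by (simp add: power2_eq_square)
      also have "c\<^sup>2 * (norm ?d)\<^sup>2 = (c * norm ?d)\<^sup>2"
        by (simp add: power_mult_distrib)
      finally have "norm (T x - T y) \<le> c * norm ?d"
        using c by (meson mult_nonneg_nonneg norm_ge_zero power2_le_imp_le)
      then show ?thesis
        by (simp add: dist_norm)
    qed
    then obtain f where "T f = f"
      using banach_fix_type[OF c] by blast
    then show ?thesis
      using t by (intro exI[of _ f]) (simp add: T_def)
  qed
  moreover have "inj S"
  proof (rule injI)
    fix x y assume "S x = S y"
    then have "A * norm (x - y) \<le> 0"
      using below[of "x - y"] by (simp add: S.diff)
    then show "x = y"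
      using AB by (simp add: mult_le_0_iff)
  qed
  ultimately show bij: "bij S"
    by (metis bijI surjI surj_def)
  have S_inv: "S (inv S y) = y" and inv_S: "inv S (S x) = x" for x y
    using bij by (simp_all add: bij_is_surj bij_is_inj surj_f_inv_f)
  show "bounded_linear (inv S)"
  proof (rule bounded_linear_intro)
    show "inv S (x + y) = inv S x + inv S y" for x y
      by (metis S.add S_inv inv_S)
    show "inv S (r *\<^sub>R x) = r *\<^sub>R inv S x" for r x
      by (metis S.scaleR S_inv inv_S)
    show "norm (inv S x) \<le> norm x * (1 / A)" for x
      using below[of "inv S x"] AB by (simp add: S_inv field_simps)
  qed
qed

lemma bounded_linear_inv_fusion_frame_operator:
  assumes W: "fusion_frame_bounds scl ip I W w A B"
  shows "bounded_linear (inv (fusion_frame_operator ip I W w))"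
  using W fusion_frame_operator_facts[OF W]
  by (intro bij_if_coercive(2)[where A = A and B = B]) (auto simp: fusion_frame_bounds_def)

text \<open>
  With both bounds equal to \<open>1\<close>, \<open>norm (S f) \<le> norm f\<close> and \<open>real_ip (S f) f \<ge> (norm f)\<^sup>2\<close>;
  expanding \<open>(norm (S f - f))\<^sup>2\<close> leaves nothing positive.
\<close>

lemma parseval_fusion_frame_operator:
  assumes W: "parseval_fusion_frame scl ip I W w"
  shows "fusion_frame_operator ip I W w = (\<lambda>f. f)"
proof
  fix f
  let ?S = "fusion_frame_operator ip I W w"
  note facts = fusion_frame_operator_facts[OF W[unfolded parseval_fusion_frame_def]]
  have "(norm (?S f - f))\<^sup>2 = (norm (?S f))\<^sup>2 - 2 * real_ip (?S f) f + (norm f)\<^sup>2"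
    by (rule norm_diff_square)
  also have "\<dots> \<le> 0"
    using facts(3)[of f] power_mono[OF facts(2)[of f] norm_ge_zero, of 2]
    unfolding mult_1 by linarith
  finally show "?S f = f"
    by simp
qed


section \<open>Perturbation of approximate alternate duals\<close>

lemma psi_eq_mixed:
  "psi ip I V v W w = mixed_operator I v (\<lambda>i. proj ip (V i))
    (inv (fusion_frame_operator ip I W w)) w (\<lambda>i. proj ip (W i))"
  by (simp add: psi_def mixed_operator_def fun_eq_iff)

lemma bessel_family_perturbation:
  assumes "perturbation scl ip I \<epsilon> U V v"
  shows "bessel_family I v (\<lambda>i f. proj ip (U i) f - proj ip (V i) f) \<epsilon>"
proof -
  have U: "closed_subspace scl (U i)" and V: "closed_subspace scl (V i)" if "i \<in> I" for i
    using assms that by (auto simp: perturbation_def weighted_subspaces_def)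
  have "linear (\<lambda>f. proj ip (U i) f - proj ip (V i) f)" if "i \<in> I" for i
    using U V that by (intro linear_compose_sub linear_proj)
  moreover have "(\<lambda>i. (v i)\<^sup>2 * (norm (proj ip (U i) f - proj ip (V i) f))\<^sup>2) summable_on I \<and>
      (\<Sum>\<^sub>\<infinity>i\<in>I. (v i)\<^sup>2 * (norm (proj ip (U i) f - proj ip (V i) f))\<^sup>2) \<le> \<epsilon> * (norm f)\<^sup>2" for f
  proof (cases "f = 0")
    case True
    have "(v i)\<^sup>2 * (norm (proj ip (U i) f - proj ip (V i) f))\<^sup>2 = 0" if "i \<in> I" for i
      using linear_0[OF linear_proj[OF U[OF that]]] linear_0[OF linear_proj[OF V[OF that]]] True
      by simp
    then show ?thesis
      by (simp add: True summable_on_0 infsum_0)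
  next
    case False
    then show ?thesis
      using assms by (auto simp: perturbation_def intro: less_imp_le)
  qed
  ultimately show ?thesis
    using U V assms unfolding bessel_family_def perturbation_def
    by (auto simp: real_ip_diff_left real_ip_diff_right proj_self_adjoint)
qed

text \<open>Uses \<open>\<parallel>x + y\<parallel>\<^sup>2 \<le> 2 \<parallel>x\<parallel>\<^sup>2 + 2 \<parallel>y\<parallel>\<^sup>2\<close>, where \<open>x\<close> is the difference of the projections.\<close>

lemma bessel_fusion_sequence_perturbation:
  assumes V: "bessel_fusion_sequence scl ip I V v" and pert: "perturbation scl ip I \<epsilon> U V v"
  shows "bessel_fusion_sequence scl ip I U v"
proof -
  obtain C where C: "C > 0"
    "\<And>f. (\<lambda>i. (v i)\<^sup>2 * (norm (proj ip (V i) f))\<^sup>2) summable_on I"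
    "\<And>f. (\<Sum>\<^sub>\<infinity>i\<in>I. (v i)\<^sup>2 * (norm (proj ip (V i) f))\<^sup>2) \<le> C * (norm f)\<^sup>2"
    using V unfolding bessel_fusion_sequence_def by blast
  have \<epsilon>: "\<epsilon> > 0" and sub: "weighted_subspaces scl I U v"
    using pert by (auto simp: perturbation_def)
  have "(\<lambda>i. (v i)\<^sup>2 * (norm (proj ip (U i) f))\<^sup>2) summable_on I \<and>
      (\<Sum>\<^sub>\<infinity>i\<in>I. (v i)\<^sup>2 * (norm (proj ip (U i) f))\<^sup>2) \<le> (2 * \<epsilon> + 2 * C) * (norm f)\<^sup>2" for f
  proof -
    define a where "a i = (v i)\<^sup>2 * (norm (proj ip (U i) f - proj ip (V i) f))\<^sup>2" for i
    define b where "b i = (v i)\<^sup>2 * (norm (proj ip (V i) f))\<^sup>2" for i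
    have a: "a summable_on I" "infsum a I \<le> \<epsilon> * (norm f)\<^sup>2"
      using bessel_family_perturbation[OF pert] unfolding bessel_family_def a_def by blast+
    have b: "b summable_on I" "infsum b I \<le> C * (norm f)\<^sup>2"
      using C unfolding b_def by blast+
    have le: "(v i)\<^sup>2 * (norm (proj ip (U i) f))\<^sup>2 \<le> 2 * a i + 2 * b i" for i
    proof -
      let ?x = "proj ip (U i) f - proj ip (V i) f" and ?y = "proj ip (V i) f"
      have "(norm (?x + ?y))\<^sup>2 \<le> 2 * (norm ?x)\<^sup>2 + 2 * (norm ?y)\<^sup>2"
        using norm_add_square[of ?x ?y] norm_diff_square[of ?x ?y] zero_le_power2[of "norm (?x - ?y)"]
        by linarith
      then have "(v i)\<^sup>2 * (norm (proj ip (U i) f))\<^sup>2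
          \<le> (v i)\<^sup>2 * (2 * (norm ?x)\<^sup>2 + 2 * (norm ?y)\<^sup>2)"
        by (intro mult_left_mono) auto
      then show ?thesis
        by (simp add: a_def b_def algebra_simps)
    qed
    have ab: "(\<lambda>i. 2 * a i + 2 * b i) summable_on I"
      using a b by (intro summable_on_add summable_on_cmult_right)
    have summable: "(\<lambda>i. (v i)\<^sup>2 * (norm (proj ip (U i) f))\<^sup>2) summable_on I"
      by (rule summable_on_comparison_test[OF ab le]) simp
    have "(\<Sum>\<^sub>\<infinity>i\<in>I. (v i)\<^sup>2 * (norm (proj ip (U i) f))\<^sup>2) \<le> (\<Sum>\<^sub>\<infinity>i\<in>I. 2 * a i + 2 * b i)"
      by (rule infsum_mono[OF summable ab le])
    also have "\<dots> = 2 * infsum a I + 2 * infsum b I"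
      using a b by (simp add: infsum_add summable_on_cmult_right infsum_cmult_right')
    finally show ?thesis
      using summable a b by (simp add: algebra_simps)
  qed
  then show ?thesis
    unfolding bessel_fusion_sequence_def using sub C(1) \<epsilon>
    by (intro conjI exI[of _ "2 * \<epsilon> + 2 * C"]) auto
qed

text \<open>
  The smallness condition is kept as a sum instead of a bound on \<open>\<epsilon>\<close> by a quotient, so that it
  also covers the zero space, where the denominator would vanish.
\<close>

lemma approximate_alternate_dual_perturbation:
  assumes W: "fusion_frame_bounds scl ip I W w A B"
    and V: "approximate_alternate_dual scl ip I V v W w"
    and pert: "perturbation scl ip I \<epsilon> U V v"
    and small: "onorm (\<lambda>f. f - psi ip I V v W w f)
      + sqrt \<epsilon> * sqrt B * onorm (inv (fusion_frame_operator ip I W w)) < 1"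
  shows "approximate_alternate_dual scl ip I U v W w"
proof -
  let ?T = "inv (fusion_frame_operator ip I W w)" and ?P = "\<lambda>i. proj ip (W i)"
  let ?E = "mixed_operator I v (\<lambda>i f. proj ip (U i) f - proj ip (V i) f) ?T w ?P"
  let ?psiU = "psi ip I U v W w" and ?psiV = "psi ip I V v W w"
  note T = bounded_linear_inv_fusion_frame_operator[OF W]
  note P = fusion_frame_bessel_family[OF W]
  have beU: "bessel_fusion_sequence scl ip I U v" and beV: "bessel_fusion_sequence scl ip I V v"
    using V pert bessel_fusion_sequence_perturbation by (auto simp: approximate_alternate_dual_def)
  then obtain D where V': "bessel_family I v (\<lambda>i. proj ip (V i)) D"
    using bessel_family_if_bessel_fusion_sequence by metis
  note E = mixed_operator_bounds(2)[OF bessel_family_perturbation[OF pert] P T]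
  have split: "f - ?psiU f = (f - ?psiV f) - ?E f" for f
  proof -
    note sums = mixed_operator_bounds(1)[OF bessel_family_perturbation[OF pert] P T, of f]
      mixed_operator_bounds(1)[OF V' P T, of f]
    have "?E f + ?psiV f = ?psiU f"
      unfolding psi_eq_mixed mixed_operator_def infsum_add[OF sums, symmetric]
      by (simp add: scaleR_diff_right)
    then show ?thesis
      by (simp add: algebra_simps)
  qed
  have lin: "bounded_linear (\<lambda>f. f - ?psiV f)"
    unfolding psi_eq_mixed using mixed_operator_bounds(3)[OF V' P T]
    by (intro bounded_linear_sub bounded_linear_ident)
  let ?k = "onorm (\<lambda>f. f - ?psiV f) + sqrt \<epsilon> * sqrt B * onorm ?T"
  have "norm (f - ?psiU f) \<le> ?k * norm f" for f
    unfolding split distrib_right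
    by (rule order_trans[OF norm_triangle_ineq4 add_mono[OF onorm[OF lin] E]])
  moreover have "0 \<le> ?k"
    using pert W onorm_pos_le[OF lin] onorm_pos_le[OF T]
    by (auto simp: perturbation_def fusion_frame_bounds_def)
  ultimately have "onorm (\<lambda>f. f - ?psiU f) \<le> ?k"
    by (intro onorm_bound)
  then show ?thesis
    using beU small by (simp add: approximate_alternate_dual_def)
qed

end

theorem theorem3p2:
  fixes scl :: "'k::hilbert_scalar \<Rightarrow> 'a::banach \<Rightarrow> 'a"
    and ip :: "'a \<Rightarrow> 'a \<Rightarrow> 'k"
    and I :: "'i set"
  assumes "hilbert_space scl ip"
    and "separable_space (euclidean :: 'a topology)"
    and "countable I"
  shows "(\<forall>W w A B V v U \<epsilon>.
            fusion_frame_bounds scl ip I W w A B \<longrightarrow>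
            approximate_alternate_dual scl ip I V v W w \<longrightarrow>
            \<epsilon> > 0 \<longrightarrow>
            perturbation scl ip I \<epsilon> U V v \<longrightarrow>
            \<epsilon> < ((1 - onorm (\<lambda>f. f - psi ip I V v W w f)) /
                  (sqrt B * onorm (inv (fusion_frame_operator ip I W w))))\<^sup>2 \<longrightarrow>
            approximate_alternate_dual scl ip I U v W w)
       \<and> (\<forall>W w U \<epsilon>.
            parseval_fusion_frame scl ip I W w \<longrightarrow>
            \<epsilon> > 0 \<longrightarrow>
            perturbation scl ip I \<epsilon> U W w \<longrightarrow>
            \<epsilon> < 1 \<longrightarrow>
            approximate_alternate_dual scl ip I U w W w)"
proof (intro conjI allI impI)
  interpret hilbert_space scl ip by (rule assms(1))
  fix W w A B V v U \<epsilon>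
  assume W: "fusion_frame_bounds scl ip I W w A B"
    and V: "approximate_alternate_dual scl ip I V v W w"
    and \<epsilon>: "\<epsilon> > 0" and pert: "perturbation scl ip I \<epsilon> U V v"
    and small: "\<epsilon> < ((1 - onorm (\<lambda>f. f - psi ip I V v W w f)) /
      (sqrt B * onorm (inv (fusion_frame_operator ip I W w))))\<^sup>2"
  let ?d = "1 - onorm (\<lambda>f. f - psi ip I V v W w f)"
  let ?K = "sqrt B * onorm (inv (fusion_frame_operator ip I W w))"
  have d: "0 < ?d"
    using V by (simp add: approximate_alternate_dual_def)
  have "0 \<le> ?K"
    using W onorm_pos_le[OF bounded_linear_inv_fusion_frame_operator[OF W]]
    by (simp add: fusion_frame_bounds_def)
  \<comment> \<open>for \<open>?K = 0\<close> the bound on \<open>\<epsilon>\<close> is a division by zero, hence \<open>0\<close>, and cannot hold\<close>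
  moreover have "?K \<noteq> 0"
  proof
    assume "?K = 0"
    then show False
      using small \<epsilon> by (simp only:) simp
  qed
  ultimately have K: "0 < ?K"
    by linarith
  have "sqrt \<epsilon> < sqrt ((?d / ?K)\<^sup>2)"
    using small by (rule real_sqrt_less_mono)
  also have "\<dots> = ?d / ?K"
    unfolding real_sqrt_abs using d K by (intro abs_of_nonneg divide_nonneg_nonneg less_imp_le)
  finally have "sqrt \<epsilon> * ?K < ?d"
    using K by (simp only: pos_less_divide_eq)
  then show "approximate_alternate_dual scl ip I U v W w"
    using approximate_alternate_dual_perturbation[OF W V pert] by (simp add: mult.assoc)
next
  interpret hilbert_space scl ip by (rule assms(1))
  fix W w U \<epsilon>
  assume pars: "parseval_fusion_frame scl ip I W w" and \<epsilon>: "\<epsilon> > 0" "\<epsilon> < 1"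
    and pert: "perturbation scl ip I \<epsilon> U W w"
  have W: "fusion_frame_bounds scl ip I W w 1 1"
    using pars by (simp add: parseval_fusion_frame_def)
  have S: "fusion_frame_operator ip I W w = (\<lambda>f. f)"
    by (rule parseval_fusion_frame_operator[OF pars])
  have inv_S: "inv (fusion_frame_operator ip I W w) = (\<lambda>f. f)"
    unfolding S by (simp add: inv_equality fun_eq_iff)
  have "psi ip I W w W w = fusion_frame_operator ip I W w"
    unfolding psi_eq_mixed inv_S
    using W by (intro fusion_frame_operator_eq_mixed[symmetric]) (simp add: fusion_frame_bounds_def)
  then have 0: "onorm (\<lambda>f. f - psi ip I W w W w f) = 0"
    by (simp add: S onorm_zero)
  have "bessel_fusion_sequence scl ip I W w"
    using W unfolding bessel_fusion_sequence_def fusion_frame_bounds_def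
    by (intro conjI exI[of _ 1]) auto
  then have V: "approximate_alternate_dual scl ip I W w W w"
    by (simp add: approximate_alternate_dual_def 0)
  have "sqrt \<epsilon> * onorm (\<lambda>f::'a. f) \<le> sqrt \<epsilon> * 1"
    using \<epsilon> by (intro mult_left_mono onorm_id_le) simp
  also have "\<dots> < 1"
    using \<epsilon> by simp
  finally show "approximate_alternate_dual scl ip I U w W w"
    by (intro approximate_alternate_dual_perturbation[OF W V pert]) (simp add: 0 inv_S)
qed

end
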